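(* For each $n\ge 2$ let $\pi$ be a uniformly random permutation in $S_n$, and define $$X_n=\frac{\mathrm{inv}(\pi)-m_n}{\sigma_n},\qquad Y_n=\frac{\mathrm{maj}(\pi)-m_n}{\sigma_n},$$ where $m_n=n(n-1)/4$ and $\sigma_n^2=\frac{2n^3+3n^2-5n}{72}$. Then for all real $s,t$, $$\lim_{n\to\infty}\Pr(X_n\le s,\ Y_n\le t)=\frac{1}{2\pi}\int_{-\infty}^{s}\int_{-\infty}^{t}e^{-x^2/2-y^2/2}\,dy\,dx .$$ That is, $(X_n,Y_n)$ converges in distribution to a pair of independent standard normal random variables. *)

theory Defs
  imports "HOL-Analysis.Analysis" "HOL-Combinatorics.Permutations"
begin

text \<open>Permutations of [n] = {1..n} are functions p with p permutes {1..n}.\<close>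

definition inv_stat :: "(nat \<Rightarrow> nat) \<Rightarrow> nat \<Rightarrow> nat" where
  "inv_stat p n = card {(i, j). 1 \<le> i \<and> i < j \<and> j \<le> n \<and> p i > p j}"

definition maj_stat :: "(nat \<Rightarrow> nat) \<Rightarrow> nat \<Rightarrow> nat" where
  "maj_stat p n = (\<Sum>i \<in> {i. 1 \<le> i \<and> i < n \<and> p i > p (Suc i)}. i)"

definition m_n :: "nat \<Rightarrow> real" where
  "m_n n = real n * (real n - 1) / 4"

definition sigma_n :: "nat \<Rightarrow> real" where
  "sigma_n n = sqrt ((2 * real n ^ 3 + 3 * real n ^ 2 - 5 * real n) / 72)"

definition joint_prob :: "nat \<Rightarrow> real \<Rightarrow> real \<Rightarrow> real" where
  "joint_prob n s t =
     real (card {p. p permutes {1..n} \<and>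
                    (real (inv_stat p n) - m_n n) / sigma_n n \<le> s \<and>
                    (real (maj_stat p n) - m_n n) / sigma_n n \<le> t})
     / real (card {p. p permutes {1..n}})"

end

theory Submission
  imports Defs "HOL-Probability.Probability" "HOL-Real_Asymp.Real_Asymp"
begin

text \<open>
  Let \<open>c\<^sub>j\<close> be the number of \<open>i < j\<close> with \<open>p i > p j\<close>. Under a uniform permutation the
  \<open>c\<^sub>j\<close> are independent and uniform on \<open>{0, \<dots>, j - 1}\<close>; moreover \<open>inv = \<Sum> c\<^sub>j\<close>, and \<open>j\<close> is a
  descent iff \<open>c\<^sub>j < c\<^sub>j\<^sub>+\<^sub>1\<close>. Hence, up to a negligible term, every linear combination of the
  centred statistics is a martingale along the chain \<open>c\<^sub>1, c\<^sub>2, \<dots>\<close> with increments of order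
  \<open>n\<^sup>-\<^sup>1\<^sup>/\<^sup>2\<close>, whose average conditional variances are, up to a negligible error, terms with sum
  exactly \<open>a\<^sup>2 + b\<^sup>2\<close>. The fluctuation of the conditional variance depends on the
  last code entry only, so it can be absorbed in a second-order correction factor; this turns the
  characteristic function into a scalar recursion with error \<open>O(n\<^sup>-\<^sup>3\<^sup>/\<^sup>2)\<close> per step.

  The passage from characteristic functions to the bivariate distribution function needs only the
  one-dimensional continuity theorem. Applied to the law of \<open>X\<close> tilted by \<open>1 + cos (b Y)\<close> and by
  \<open>1 + sin (b Y)\<close>, it gives the limit of \<open>E [1\<^bsub>X \<le> s\<^esub> exp (i b Y)]\<close>; applied once more to
  the law of \<open>Y\<close> given \<open>X \<le> s\<close>, it gives the result.
\<close>

section \<open>Codes of permutations\<close>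

text \<open>Restricted to \<open>{1..n}\<close> so that a code lies in the extensional product
  \<open>codes n\<close>, where agreement on \<open>{1..n}\<close> is equality.\<close>

definition lehmer_code :: "nat \<Rightarrow> (nat \<Rightarrow> nat) \<Rightarrow> nat \<Rightarrow> nat" where
  "lehmer_code n p = (\<lambda>j\<in>{1..n}. card {i\<in>{1..<j}. p i > p j})"

abbreviation codes :: "nat \<Rightarrow> (nat \<Rightarrow> nat) set" where
  "codes n \<equiv> PiE {1..n} (\<lambda>j. {..<j})"

lemma finite_codes: "finite (codes n)"
  by (intro finite_PiE) auto

lemma card_codes: "card (codes n) = fact n"
  by (simp add: card_PiE fact_prod)

lemma lehmer_code_in_codes: "lehmer_code n p \<in> codes n"
proof -
  have "card {i\<in>{1..<j}. p i > p j} < j" if "1 \<le> j" for j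
  proof -
    have "card {i\<in>{1..<j}. p i > p j} \<le> card {1..<j}"
      by (intro card_mono) auto
    with that show ?thesis by simp
  qed
  then show ?thesis by (auto simp: lehmer_code_def)
qed

text \<open>A permutation is recovered from right to left: once its values after \<open>j\<close>
  are known, so is the set of its values on \<open>{1..j}\<close>, and the code entry at
  \<open>j\<close> is the rank from above of \<open>p j\<close> in that set.\<close>

lemma inj_on_lehmer_code: "inj_on (lehmer_code n) {p. p permutes {1..n}}"
proof (rule inj_onI, clarify)
  fix p q assume p: "p permutes {1..n}" and q: "q permutes {1..n}"
    and eq: "lehmer_code n p = lehmer_code n q"
  have agree: "p j = q j" if "j \<in> {1..n}" for j
    using that
  proof (induction "n - j" arbitrary: j rule: less_induct)
    case less
    have tail: "p i = q i" if "i \<in> {Suc j..n}" for i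
      using less.hyps[of i] less.prems that by auto
    have im: "f ` {1..j} = {1..n} - f ` {Suc j..n}" if f: "f permutes {1..n}" for f
    proof -
      have "f ` {1..j} = f ` ({1..n} - {Suc j..n})"
        using less.prems by (intro arg_cong[where f = "image f"]) auto
      also have "\<dots> = {1..n} - f ` {Suc j..n}"
        using permutes_inj[OF f] permutes_image[OF f] by (simp add: image_set_diff)
      finally show ?thesis .
    qed
    define S where "S = p ` {1..j}"
    have Sq: "S = q ` {1..j}"
      using im[OF p] im[OF q] tail unfolding S_def by (auto simp: image_iff)
    have rank: "lehmer_code n f j = card {v\<in>f ` {1..j}. v > f j}"
      if f: "f permutes {1..n}" for f
    proof -
      have "{v\<in>f ` {1..j}. v > f j} = f ` {i\<in>{1..<j}. f i > f j}"
        using less.prems by (auto simp: image_iff order.order_iff_strict)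
      then show ?thesis
        using less.prems permutes_inj[OF f]
        by (simp add: lehmer_code_def card_image inj_on_subset[OF _ subset_UNIV])
    qed
    \<comment> \<open>A larger member of \<open>S\<close> has strictly fewer members above it, so
      equal ranks force equal values.\<close>
    have mono: "card {v\<in>S. v > y} < card {v\<in>S. v > x}" if "x < y" "y \<in> S" for x y
      by (rule psubset_card_mono) (use that in \<open>auto simp: S_def\<close>)
    have "card {v\<in>S. v > p j} = card {v\<in>S. v > q j}"
      using rank[OF p] rank[OF q] eq Sq S_def by metis
    moreover have "p j \<in> S" "q j \<in> S"
      using less.prems by (simp add: S_def) (use less.prems in \<open>simp add: Sq\<close>)
    ultimately show ?case
      using mono[of "p j" "q j"] mono[of "q j" "p j"] by (cases "p j" "q j" rule: linorder_cases) auto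
  qed
  show "p = q"
  proof
    fix j show "p j = q j"
      using agree permutes_not_in[OF p] permutes_not_in[OF q] by (cases "j \<in> {1..n}") auto
  qed
qed

text \<open>An injection into a finite set of the same size \<open>fact n\<close> is onto.\<close>

lemma bij_betw_lehmer_code: "bij_betw (lehmer_code n) {p. p permutes {1..n}} (codes n)"
  unfolding bij_betw_def
proof (intro conjI card_subset_eq)
  show "card (lehmer_code n ` {p. p permutes {1..n}}) = card (codes n)"
    using card_permutations[of "{1..n}" n]
    by (simp only: card_image[OF inj_on_lehmer_code] card_codes card_atLeastAtMost) simp
qed (use inj_on_lehmer_code in \<open>simp_all only: image_subset_iff lehmer_code_in_codes finite_codes simp_thms Ball_def\<close>)

section \<open>Inversions and major index in terms of the code\<close>

lemma inv_stat_lehmer_code: "inv_stat p n = (\<Sum>j=1..n. lehmer_code n p j)"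
proof -
  have "{(i, j). 1 \<le> i \<and> i < j \<and> j \<le> n \<and> p i > p j}
      = (\<lambda>(j, i). (i, j)) ` (SIGMA j:{1..n}. {i\<in>{1..<j}. p i > p j})"
    by (auto simp: image_iff)
  moreover have "inj_on (\<lambda>(j, i). (i, j)) A" for A :: "(nat \<times> nat) set"
    by (auto simp: inj_on_def)
  ultimately show ?thesis
    by (simp add: inv_stat_def card_image lehmer_code_def)
qed

text \<open>The sets counted by neighbouring entries are nested: at a descent, \<open>j\<close> and
  everything counted at \<open>j\<close> is counted at \<open>Suc j\<close>; at an ascent, the set
  at \<open>Suc j\<close> lies inside the one at \<open>j\<close>.\<close>

lemma descent_iff_lehmer_code:
  assumes p: "p permutes {1..n}" and j: "1 \<le> j" "j < n"
  shows "p j > p (Suc j) \<longleftrightarrow> lehmer_code n p j < lehmer_code n p (Suc j)"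
proof -
  have ne: "p j \<noteq> p (Suc j)"
    using permutes_inj[OF p] by (metis injD n_not_Suc_n)
  let ?G = "\<lambda>j. {i\<in>{1..<j}. p i > p j}"
  show ?thesis
  proof (cases "p j > p (Suc j)")
    case True
    then have "insert j (?G j) \<subseteq> ?G (Suc j)"
      using j by auto
    then have "card (insert j (?G j)) \<le> card (?G (Suc j))"
      by (intro card_mono) auto
    with True j show ?thesis by (simp add: lehmer_code_def)
  next
    case False
    with ne have "?G (Suc j) \<subseteq> ?G j"
      by (auto simp: less_Suc_eq)
    then have "card (?G (Suc j)) \<le> card (?G j)"
      by (intro card_mono) auto
    with False j show ?thesis by (simp add: lehmer_code_def)
  qed
qed

lemma maj_stat_lehmer_code:
  assumes p: "p permutes {1..n}"
  shows "maj_stat p n = (\<Sum>j=1..<n. j * of_bool (lehmer_code n p j < lehmer_code n p (Suc j)))"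
proof -
  have "(\<Sum>j=1..<n. j * of_bool (lehmer_code n p j < lehmer_code n p (Suc j)))
      = (\<Sum>j=1..<n. if p j > p (Suc j) then j else 0)"
    using descent_iff_lehmer_code[OF p] by (intro sum.cong) auto
  also have "\<dots> = maj_stat p n"
    unfolding maj_stat_def by (subst sum.inter_filter[symmetric]) (auto intro!: sum.cong)
  finally show ?thesis ..
qed

text \<open>Independence of the code entries in summation form: the new entry runs over
  \<open>{..m}\<close> whatever the earlier ones are.\<close>

lemma sum_codes_Suc:
  fixes f :: "(nat \<Rightarrow> nat) \<Rightarrow> 'a :: comm_monoid_add"
  shows "(\<Sum>c\<in>codes (Suc m). f c) = (\<Sum>c\<in>codes m. \<Sum>y\<le>m. f (c(Suc m := y)))"
proof -
  have "codes (Suc m) = (\<lambda>(y, c). c(Suc m := y)) ` ({..m} \<times> codes m)"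
    using PiE_insert_eq[of "Suc m" "{1..m}" "\<lambda>j. {..<j}"]
    by (simp add: atLeastAtMostSuc_conv lessThan_Suc_atMost)
  moreover have "inj_on (\<lambda>(y, c). c(Suc m := y)) ({..m} \<times> codes m)"
    using inj_combinator[of "Suc m" "{1..m}" "\<lambda>j. {..<j}"]
    by (simp add: lessThan_Suc_atMost)
  ultimately have "(\<Sum>c\<in>codes (Suc m). f c) = (\<Sum>(y, c)\<in>{..m} \<times> codes m. f (c(Suc m := y)))"
    by (simp add: sum.reindex case_prod_unfold)
  also have "\<dots> = (\<Sum>y\<le>m. \<Sum>c\<in>codes m. f (c(Suc m := y)))"
    by (simp add: sum.cartesian_product)
  finally show ?thesis by (simp add: sum.swap[of _ "{..m}"])
qed

section \<open>Increments along the code\<close>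

text \<open>
  For \<open>A = a / \<sigma>\<close> and \<open>B = b / \<sigma>\<close> this is the martingale increment when the code entry \<open>y\<close> follows
  \<open>x = c\<^sub>m\<close>. The weight \<open>m + 1\<close> of a descent, instead of the \<open>m\<close> of \<open>maj\<close>, makes the mean exactly zero;
  the resulting discrepancy is of order \<open>B n\<close> (see \<open>statistics_eq_sum_code_incr\<close>).
\<close>

definition code_incr :: "real \<Rightarrow> real \<Rightarrow> nat \<Rightarrow> nat \<Rightarrow> nat \<Rightarrow> real" where
  "code_incr A B m x y =
     (A - B) * (real y - real m / 2) + B * ((real m + 1) * of_bool (x < y) - (real m - real x))"

text \<open>Half the deviation of the conditional variance from its mean over \<open>x < m\<close>.\<close>

definition var_corr :: "real \<Rightarrow> real \<Rightarrow> nat \<Rightarrow> nat \<Rightarrow> real" where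
  "var_corr A B m x =
     A * B / 2 * ((real m - real x) * (real x + 1) - (real m + 1) * (real m + 2) / 6)"

text \<open>The mean conditional variance without its negligible part \<open>A * B * (m + 2) / 6\<close>.\<close>

definition avg_var :: "real \<Rightarrow> real \<Rightarrow> nat \<Rightarrow> real" where
  "avg_var A B m = (A\<^sup>2 + B\<^sup>2) * ((real m + 1)\<^sup>2 - 1) / 12"

section \<open>Conditional first and second moments of the increments\<close>

lemma sum_centered: "(\<Sum>y\<le>m. real y - real m / 2) = 0"
proof -
  have "(\<Sum>y\<le>m. real y) = real m * (real m + 1) / 2"
    by (induction m) (auto simp: field_simps)
  then show ?thesis by (simp add: sum_subtractf)
qed

lemma sum_centered_sq:
  "(\<Sum>y\<le>m. (real y - real m / 2)\<^sup>2) = (real m + 1) * ((real m + 1)\<^sup>2 - 1) / 12"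
proof -
  \<comment> \<open>The centre stays a free \<open>t\<close>, since \<open>m / 2\<close> would move
    during the induction.\<close>
  have "(\<Sum>y\<le>m. (real y - t)\<^sup>2) =
      real m * (real m + 1) * (2 * real m + 1) / 6 - t * real m * (real m + 1) + (real m + 1) * t\<^sup>2" for t
    by (induction m) (auto simp: field_simps power2_eq_square)
  from this[of "real m / 2"] show ?thesis
    by (simp add: field_simps power2_eq_square)
qed

lemma sum_of_bool_less:
  assumes "x \<le> m" shows "(\<Sum>y\<le>m. of_bool (x < y)) = real m - real x"
  using assms by (induction m rule: dec_induct) (auto simp: not_less intro!: sum.neutral)

lemma sum_of_bool_less_centered:
  assumes "x \<le> m"
  shows "(\<Sum>y\<le>m. of_bool (x < y) * (real y - real m / 2)) = (real m - real x) * (real x + 1) / 2"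
proof -
  have "(\<Sum>y\<le>m. of_bool (x < y) * (real y - t)) =
      (real m * (real m + 1) - real x * (real x + 1)) / 2 - t * (real m - real x)" for t
    using assms
    by (induction m rule: dec_induct) (auto simp: not_less field_simps intro!: sum.neutral)
  from this[of "real m / 2"] show ?thesis
    by (simp add: field_simps)
qed

text \<open>A uniform \<open>y\<close> in \<open>{..m}\<close> has mean \<open>m / 2\<close> and
  exceeds \<open>x\<close> with probability \<open>(m - x) / (m + 1)\<close>, so both parts of the
  increment are centred.\<close>

lemma sum_code_incr:
  assumes "x \<le> m" shows "(\<Sum>y\<le>m. code_incr A B m x y) = 0"
proof -
  have "(\<Sum>y\<le>m. code_incr A B m x y) = (A - B) * (\<Sum>y\<le>m. real y - real m / 2)
      + B * ((real m + 1) * (\<Sum>y\<le>m. of_bool (x < y)) - (real m + 1) * (real m - real x))"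
    unfolding code_incr_def by (simp add: sum.distrib sum_subtractf flip: sum_distrib_left)
  then show ?thesis
    by (simp only: sum_centered sum_of_bool_less[OF assms]) simp
qed

text \<open>The conditional variance depends on \<open>x\<close> through
  \<open>(m - x) * (x + 1)\<close> alone. Its coefficient is \<open>B\<^sup>2\<close> from the
  descent indicator plus \<open>(A - B) * B\<close> from the covariance with \<open>y\<close>, hence
  \<open>A * B\<close>, the factor in \<open>var_corr\<close>.\<close>

lemma sum_code_incr_sq:
  assumes "x \<le> m"
  shows "(\<Sum>y\<le>m. (code_incr A B m x y)\<^sup>2) =
    (real m + 1) * (avg_var A B m + 2 * var_corr A B m x + A * B * (real m + 2) / 6)"
proof -
  define u where "u y = real y - real m / 2" for y
  have expand: "(code_incr A B m x y)\<^sup>2 =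
      (A - B)\<^sup>2 * (u y)\<^sup>2
      + 2 * (A - B) * B * (real m + 1) * (of_bool (x < y) * u y)
      - 2 * (A - B) * B * (real m - real x) * u y
      + B\<^sup>2 * ((real m + 1)\<^sup>2 - 2 * (real m + 1) * (real m - real x)) * of_bool (x < y)
      + B\<^sup>2 * (real m - real x)\<^sup>2" for y
    by (cases "x < y") (simp_all add: code_incr_def u_def power2_eq_square field_simps)
  have "(\<Sum>y\<le>m. (code_incr A B m x y)\<^sup>2) =
      (A - B)\<^sup>2 * (\<Sum>y\<le>m. (u y)\<^sup>2)
      + 2 * (A - B) * B * (real m + 1) * (\<Sum>y\<le>m. of_bool (x < y) * u y)
      - 2 * (A - B) * B * (real m - real x) * (\<Sum>y\<le>m. u y)
      + B\<^sup>2 * ((real m + 1)\<^sup>2 - 2 * (real m + 1) * (real m - real x)) * (\<Sum>y\<le>m. of_bool (x < y))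
      + (real m + 1) * (B\<^sup>2 * (real m - real x)\<^sup>2)"
    unfolding expand sum.distrib sum_subtractf sum_distrib_left by simp
  also have "\<dots> = (real m + 1) * (avg_var A B m + 2 * var_corr A B m x + A * B * (real m + 2) / 6)"
    unfolding u_def sum_centered sum_centered_sq sum_of_bool_less[OF assms]
      sum_of_bool_less_centered[OF assms] avg_var_def var_corr_def by (simp add: field_simps power2_eq_square)
  finally show ?thesis .
qed

text \<open>The correction at the new level averages out over the new entry, so it leaves no
  first-order trace in \<open>transition_estimate\<close>.\<close>

lemma sum_var_corr: "(\<Sum>y\<le>m. var_corr A B (Suc m) y) = 0"
proof -
  have "(\<Sum>y\<le>m. (t - real y) * (real y + 1)) =
      t * (real m + 1) * (real m + 2) / 2 - real m * (real m + 1) * (real m + 2) / 3" for t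
    by (induction m) (auto simp: field_simps)
  from this[of "real (Suc m)"] show ?thesis
    unfolding var_corr_def sum_distrib_left[symmetric] sum_subtractf by simp (simp add: field_simps)
qed

section \<open>Uniform size bounds\<close>

lemma abs_mult_le_add_sq: "\<bar>a * b\<bar> \<le> (\<bar>a\<bar> + \<bar>b\<bar>)\<^sup>2" for a b :: real
  by (simp add: abs_mult power2_sum)

lemma abs_code_incr_le:
  assumes "x \<le> m" "y \<le> m" "m < n"
  shows "\<bar>code_incr A B m x y\<bar> \<le> 2 * (\<bar>A\<bar> + \<bar>B\<bar>) * real n"
proof -
  have "\<bar>code_incr A B m x y\<bar> \<le> \<bar>A - B\<bar> * \<bar>real y - real m / 2\<bar>
      + \<bar>B\<bar> * \<bar>(real m + 1) * of_bool (x < y) - (real m - real x)\<bar>"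
    unfolding code_incr_def by (rule order_trans[OF abs_triangle_ineq]) (simp add: abs_mult)
  also have "\<dots> \<le> (\<bar>A\<bar> + \<bar>B\<bar>) * real n + (\<bar>A\<bar> + \<bar>B\<bar>) * real n"
    using assms by (intro add_mono mult_mono) (auto simp: abs_le_iff)
  finally show ?thesis by (simp add: algebra_simps)
qed

lemma abs_var_corr_le:
  assumes "x < m" "m \<le> n"
  shows "\<bar>var_corr A B m x\<bar> \<le> (\<bar>A\<bar> + \<bar>B\<bar>)\<^sup>2 * (real n)\<^sup>2 / 2"
proof -
  have box: "\<bar>u - v / 6\<bar> \<le> w" if "u \<le> w" "0 \<le> u" "v \<le> 6 * w" "0 \<le> v" for u v w :: real
    using that by auto
  have m: "1 \<le> real m" using assms by simp
  have "(real m - real x) * (real x + 1) \<le> real m * real m"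
    using assms by (intro mult_mono) auto
  moreover have "0 \<le> (real m - real x) * (real x + 1)"
    using assms by (intro mult_nonneg_nonneg) auto
  moreover have "(real m + 1) * (real m + 2) \<le> (real m + real m) * (real m + 2 * real m)"
    using m by (intro mult_mono) auto
  moreover have "0 \<le> (real m + 1) * (real m + 2)"
    by simp
  ultimately have "\<bar>(real m - real x) * (real x + 1) - (real m + 1) * (real m + 2) / 6\<bar> \<le> real m * real m"
    using box[of "(real m - real x) * (real x + 1)" "real m * real m" "(real m + 1) * (real m + 2)"]
    by (simp add: mult.assoc)
  also have "\<dots> \<le> (real n)\<^sup>2"
    unfolding power2_eq_square using assms by (intro mult_mono) auto
  finally have "\<bar>A * B\<bar> * \<bar>(real m - real x) * (real x + 1) - (real m + 1) * (real m + 2) / 6\<bar>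
      \<le> (\<bar>A\<bar> + \<bar>B\<bar>)\<^sup>2 * (real n)\<^sup>2"
    using abs_mult_le_add_sq by (intro mult_mono) auto
  then show ?thesis
    by (simp add: var_corr_def abs_mult)
qed

lemma avg_var_bounds:
  assumes "m < n"
  shows "0 \<le> avg_var A B m" "avg_var A B m \<le> (\<bar>A\<bar> + \<bar>B\<bar>)\<^sup>2 * (real n)\<^sup>2 / 12"
proof -
  have 1: "0 \<le> (real m + 1)\<^sup>2 - 1" by (simp add: power2_eq_square algebra_simps)
  then show "0 \<le> avg_var A B m" unfolding avg_var_def by simp
  have "A\<^sup>2 + B\<^sup>2 \<le> (\<bar>A\<bar> + \<bar>B\<bar>)\<^sup>2"
    by (simp add: power2_sum)
  moreover have "(real m + 1)\<^sup>2 - 1 \<le> (real n)\<^sup>2"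
    using assms power_mono[of "real m + 1" "real n" 2] by linarith
  ultimately show "avg_var A B m \<le> (\<bar>A\<bar> + \<bar>B\<bar>)\<^sup>2 * (real n)\<^sup>2 / 12"
    unfolding avg_var_def using 1 by (intro divide_right_mono mult_mono) (auto simp del: of_nat_power)
qed

section \<open>Second-order expansion of one step\<close>

lemma exp_minus_bounds:
  fixes u :: real assumes "0 \<le> u"
  shows "\<bar>1 - exp (- u)\<bar> \<le> u" "\<bar>1 - u - exp (- u)\<bar> \<le> u\<^sup>2"
proof -
  have a: "exp (- u) \<ge> 1 - u" using exp_ge_add_one_self[of "-u"] by simp
  then show "\<bar>1 - exp (- u)\<bar> \<le> u" using assms by simp
  have "exp (- u) * (1 + u) \<le> 1"
    using exp_ge_add_one_self[of u] by (simp add: exp_minus field_simps)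
  \<comment> \<open>The product equals \<open>1 + u ^ 3\<close>.\<close>
  moreover have "1 \<le> (1 - u + u\<^sup>2) * (1 + u)"
    using assms by (simp add: power2_eq_square algebra_simps)
  ultimately have "exp (- u) * (1 + u) \<le> (1 - u + u\<^sup>2) * (1 + u)" by simp
  then have "exp (- u) \<le> 1 - u + u\<^sup>2" using assms by simp
  with a show "\<bar>1 - u - exp (- u)\<bar> \<le> u\<^sup>2" by simp
qed

lemma iexp_taylor2: "cmod (iexp x - (1 + \<i> * x - x\<^sup>2 / 2)) \<le> \<bar>x\<bar> ^ 3 / 6"
  using iexp_approx1[of x 2] by (simp add: numeral_eq_Suc power2_eq_square algebra_simps)

lemma iexp_taylor0: "cmod (iexp x - 1) \<le> \<bar>x\<bar>"
  using iexp_approx1[of x 0] by simp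

text \<open>To second order, averaging over \<open>y\<close> gives
  \<open>1 - avg_var / 2 - var_corr\<close> at \<open>x\<close>, because the increments and the new
  correction have mean zero. The factor \<open>1 - var_corr\<close> thus reproduces itself one level
  down, times a number free of \<open>x\<close>. For \<open>L\<close> of order \<open>n\<close> to
  the power -3/2, \<open>d\<close> has order \<open>n\<close> to the power -1/2 and the error is of
  order \<open>d ^ 3\<close>.\<close>

lemma transition_estimate:
  fixes A B :: real
  assumes "x < m" "m < n"
  defines "L \<equiv> \<bar>A\<bar> + \<bar>B\<bar>"
  defines "d \<equiv> 2 * L * real n"
  shows "cmod ((\<Sum>y\<le>m. iexp (code_incr A B m x y) * of_real (1 - var_corr A B (Suc m) y)) / (real m + 1)
      - of_real ((1 - var_corr A B m x) * exp (- avg_var A B m / 2))) \<le> d ^ 3 + d ^ 4 + L\<^sup>2 * real n"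
    (is "cmod (?S / _ - of_real ?R) \<le> _")
proof -
  let ?\<xi> = "code_incr A B m x" and ?g = "var_corr A B (Suc m)" and ?h = "var_corr A B m x" and ?e = "avg_var A B m"
  have L: "0 \<le> L" by (simp add: L_def)
  then have d: "0 \<le> d" by (simp add: d_def)
  have d2: "d\<^sup>2 = 4 * (L\<^sup>2 * (real n)\<^sup>2)" by (simp add: d_def power_mult_distrib)
  have \<xi>: "\<bar>?\<xi> y\<bar> \<le> d" if "y \<le> m" for y
    using abs_code_incr_le[of x m y n A B] assms that by (simp add: L_def d_def)
  have g: "\<bar>?g y\<bar> \<le> d\<^sup>2 / 8" if "y \<le> m" for y
    using abs_var_corr_le[of y "Suc m" n A B] assms(1,2) that by (simp add: L_def d2 mult.commute)
  have h: "\<bar>?h\<bar> \<le> d\<^sup>2 / 8"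
    using abs_var_corr_le[of x m n A B] assms(1,2) by (simp add: L_def d2 mult.commute)
  have e: "0 \<le> ?e" "?e \<le> d\<^sup>2 / 8"
    using avg_var_bounds[of m n A B] assms(1,2) by (simp_all add: L_def d2 mult.commute)
  \<comment> \<open>The increment has size \<open>d\<close> and the correction size
    \<open>d\<^sup>2\<close>, so their product belongs to the cubic error and is dropped
    here.\<close>
  let ?T = "\<lambda>y. 1 + \<i> * of_real (?\<xi> y) - of_real ((?\<xi> y)\<^sup>2) / 2 - of_real (?g y)"
  have term_le: "cmod (iexp (?\<xi> y) * of_real (1 - ?g y) - ?T y) \<le> d ^ 3 / 2" if "y \<le> m" for y
  proof -
    have "iexp (?\<xi> y) * of_real (1 - ?g y) - ?T y =
        (iexp (?\<xi> y) - (1 + \<i> * ?\<xi> y - (?\<xi> y)\<^sup>2 / 2)) - of_real (?g y) * (iexp (?\<xi> y) - 1)"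
      by (simp add: algebra_simps)
    also have "cmod \<dots> \<le> \<bar>?\<xi> y\<bar> ^ 3 / 6 + \<bar>?g y\<bar> * \<bar>?\<xi> y\<bar>"
      by (rule order_trans[OF norm_triangle_ineq4], rule add_mono[OF iexp_taylor2])
        (simp add: norm_mult mult_left_mono iexp_taylor0)
    also have "\<dots> \<le> d ^ 3 / 6 + d\<^sup>2 / 8 * d"
      using \<xi>[OF that] g[OF that] by (intro add_mono divide_right_mono power_mono mult_mono) auto
    also have "\<dots> \<le> d ^ 3 / 2"
      using zero_le_power[OF d, of 3] by (simp add: power2_eq_square power3_eq_cube)
    finally show ?thesis .
  qed
  have "cmod (?S - (\<Sum>y\<le>m. ?T y)) \<le> (\<Sum>y\<le>m. d ^ 3 / 2)"
    unfolding sum_subtractf[symmetric] by (rule sum_norm_le) (use term_le in simp)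
  also have "\<dots> = (real m + 1) * (d ^ 3 / 2)" by simp
  finally have S: "cmod (?S - (\<Sum>y\<le>m. ?T y)) \<le> (real m + 1) * (d ^ 3 / 2)" .
  have "(\<Sum>y\<le>m. ?T y) = of_real (real m + 1) + \<i> * of_real (\<Sum>y\<le>m. ?\<xi> y)
      - of_real (\<Sum>y\<le>m. (?\<xi> y)\<^sup>2) / 2 - of_real (\<Sum>y\<le>m. ?g y)"
    by (simp add: sum.distrib sum_subtractf sum_distrib_left sum_divide_distrib)
  also have "\<dots> = of_real (real m + 1) * of_real (1 - ?e / 2 - ?h - A * B * (real m + 2) / 12)"
    using assms by (simp only: sum_code_incr sum_code_incr_sq sum_var_corr less_imp_le) (simp add: field_simps)
  finally have T_mult: "(\<Sum>y\<le>m. ?T y) = of_real (real m + 1) * of_real (1 - ?e / 2 - ?h - A * B * (real m + 2) / 12)" .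
  have N: "complex_of_real (real m + 1) \<noteq> 0"
    unfolding of_real_eq_0_iff by linarith
  have T: "(\<Sum>y\<le>m. ?T y) / (real m + 1) = of_real (1 - ?e / 2 - ?h - A * B * (real m + 2) / 12)"
    by (simp only: T_mult nonzero_mult_div_cancel_left[OF N])
  \<comment> \<open>Three errors: passing from \<open>1 - ?e / 2\<close> to the exponential, the
    product of \<open>?h\<close> with one minus that exponential, and the part of the variance that
    \<open>avg_var\<close> omits.\<close>
  have rem: "\<bar>(1 - ?e / 2 - ?h - A * B * (real m + 2) / 12) - ?R\<bar> \<le> d ^ 4 + L\<^sup>2 * real n"
  proof -
    have "\<bar>(1 - ?e / 2 - ?h - A * B * (real m + 2) / 12) - ?R\<bar> =
        \<bar>(1 - ?e / 2 - exp (- (?e / 2))) - ?h * (1 - exp (- (?e / 2))) - A * B * ((real m + 2) / 12)\<bar>"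
      by (simp add: algebra_simps)
    also have "\<dots> \<le> \<bar>1 - ?e / 2 - exp (- (?e / 2))\<bar> + \<bar>?h\<bar> * \<bar>1 - exp (- (?e / 2))\<bar>
        + \<bar>A * B\<bar> * ((real m + 2) / 12)"
      using abs_triangle_ineq4[of "1 - ?e / 2 - exp (- (?e / 2)) - ?h * (1 - exp (- (?e / 2)))" "A * B * ((real m + 2) / 12)"]
        abs_triangle_ineq4[of "1 - ?e / 2 - exp (- (?e / 2))" "?h * (1 - exp (- (?e / 2)))"]
      by (simp add: abs_mult)
    also have "\<dots> \<le> (?e / 2)\<^sup>2 + d\<^sup>2 / 8 * (?e / 2) + L\<^sup>2 * real n"
      using exp_minus_bounds[of "?e / 2"] h e abs_mult_le_add_sq[of A B] assms
      by (intro add_mono mult_mono) (auto simp: L_def)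
    also have "\<dots> \<le> (d\<^sup>2 / 8)\<^sup>2 + d\<^sup>2 / 8 * (d\<^sup>2 / 8) + L\<^sup>2 * real n"
      using e L by (intro add_mono power_mono mult_mono) auto
    also have "\<dots> \<le> d ^ 4 + L\<^sup>2 * real n"
      using zero_le_power[OF d, of 4] by (simp add: power2_eq_square numeral_eq_Suc)
    finally show ?thesis .
  qed
  have norm_diff_div: "cmod (z / (real m + 1) - w / (real m + 1)) = cmod (z - w) / (real m + 1)" for z w :: complex
    unfolding diff_divide_distrib[symmetric] norm_divide norm_of_real by simp
  have "cmod (?S / (real m + 1) - of_real ?R) \<le>
      cmod (?S / (real m + 1) - (\<Sum>y\<le>m. ?T y) / (real m + 1)) + cmod ((\<Sum>y\<le>m. ?T y) / (real m + 1) - of_real ?R)"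
    by (rule order_trans[OF _ norm_triangle_ineq]) simp
  also have "cmod (?S / (real m + 1) - (\<Sum>y\<le>m. ?T y) / (real m + 1)) = cmod (?S - (\<Sum>y\<le>m. ?T y)) / (real m + 1)"
    by (rule norm_diff_div)
  also have "\<dots> \<le> (real m + 1) * (d ^ 3 / 2) / (real m + 1)"
    by (intro divide_right_mono S) simp
  also have "\<dots> = d ^ 3 / 2"
    by (rule nonzero_mult_div_cancel_left) linarith
  also have "cmod ((\<Sum>y\<le>m. ?T y) / (real m + 1) - of_real ?R) \<le> d ^ 4 + L\<^sup>2 * real n"
    unfolding T of_real_diff[symmetric] norm_of_real by (rule rem)
  finally show ?thesis
    using zero_le_power[OF d, of 3] by linarith
qed

section \<open>Characteristic functions\<close>

text \<open>Summing out the last entry by \<open>transition_estimate\<close> turns the corrected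
  average into the previous one times a deterministic factor, up to one step error.\<close>

lemma char_partial_sums_estimate:
  fixes A B :: real
  assumes "1 \<le> m" "m \<le> n"
  defines "L \<equiv> \<bar>A\<bar> + \<bar>B\<bar>"
  defines "d \<equiv> 2 * L * real n"
  shows "cmod ((\<Sum>c\<in>codes m. iexp (\<Sum>j=1..<m. code_incr A B j (c j) (c (Suc j))) * of_real (1 - var_corr A B m (c m))) / fact m
      - of_real (exp (- (\<Sum>j=1..<m. avg_var A B j) / 2))) \<le> real m * (d ^ 3 + d ^ 4 + L\<^sup>2 * real n)"
  using assms(1,2)
proof (induction m rule: dec_induct)
  case base
  \<comment> \<open>The only code is zero, the sums are empty, and
    \<open>var_corr A B 1 0 = 0\<close>.\<close>
  have "codes 1 = {\<lambda>j\<in>{1}. 0}"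
    by (auto simp: PiE_def extensional_def Pi_def restrict_def fun_eq_iff)
  then show ?case
    by (simp add: var_corr_def d_def L_def)
next
  case (step m)
  let ?\<epsilon> = "d ^ 3 + d ^ 4 + L\<^sup>2 * real n"
  let ?T = "\<lambda>m c. iexp (\<Sum>j=1..<m. code_incr A B j (c j) (c (Suc j)))"
  let ?E = "\<lambda>m. (\<Sum>c\<in>codes m. ?T m c * of_real (1 - var_corr A B m (c m))) / fact m"
  let ?v = "exp (- avg_var A B m / 2)"
  let ?V = "\<lambda>m. exp (- (\<Sum>j=1..<m. avg_var A B j) / 2)"
  let ?S = "\<lambda>x. (\<Sum>y\<le>m. iexp (code_incr A B m x y) * of_real (1 - var_corr A B (Suc m) y)) / (real m + 1)"
  have mn: "m < n" and m1: "1 \<le> m" using step by auto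
  have T_Suc: "?T (Suc m) (c(Suc m := y)) = ?T m c * iexp (code_incr A B m (c m) y)" for c y
  proof -
    have "(\<Sum>j=1..<m. code_incr A B j ((c(Suc m := y)) j) ((c(Suc m := y)) (Suc j)))
        = (\<Sum>j=1..<m. code_incr A B j (c j) (c (Suc j)))"
      by (intro sum.cong) auto
    then show ?thesis using m1 by (simp add: exp_add distrib_left del: fun_upd_apply) simp
  qed
  have "?E (Suc m) = (\<Sum>c\<in>codes m. \<Sum>y\<le>m. ?T m c * (iexp (code_incr A B m (c m) y) * of_real (1 - var_corr A B (Suc m) y))) / fact (Suc m)"
    by (simp only: sum_codes_Suc T_Suc fun_upd_same mult.assoc)
  also have "\<dots> = (\<Sum>c\<in>codes m. ?T m c * ?S (c m)) / fact m"
    by (simp add: sum_divide_distrib sum_distrib_left fact_Suc mult.commute add.commute)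
  finally have E_Suc: "?E (Suc m) = (\<Sum>c\<in>codes m. ?T m c * ?S (c m)) / fact m" .
  have split: "(\<Sum>c\<in>codes m. f c * (h c - of_real (g c * v)))
      = (\<Sum>c\<in>codes m. f c * h c) - of_real v * (\<Sum>c\<in>codes m. f c * of_real (g c))"
    for f h :: "(nat \<Rightarrow> nat) \<Rightarrow> complex" and g and v :: real
    by (simp add: right_diff_distrib sum_subtractf sum_distrib_left mult_ac)
  have "?E (Suc m) - of_real ?v * ?E m =
      (\<Sum>c\<in>codes m. ?T m c * (?S (c m) - of_real ((1 - var_corr A B m (c m)) * ?v))) / fact m"
    unfolding E_Suc split by (simp only: times_divide_eq_right diff_divide_distrib)
  also have "cmod \<dots> \<le> ?\<epsilon>"
  proof -
    have "cmod (\<Sum>c\<in>codes m. ?T m c * (?S (c m) - of_real ((1 - var_corr A B m (c m)) * ?v)))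
        \<le> (\<Sum>c\<in>codes m. ?\<epsilon>)"
    proof (rule sum_norm_le)
      fix c assume "c \<in> codes m"
      then have "c m < m" using m1 by (auto simp: PiE_iff)
      from transition_estimate[OF this mn, of A B]
      show "cmod (?T m c * (?S (c m) - of_real ((1 - var_corr A B m (c m)) * ?v))) \<le> ?\<epsilon>"
        by (simp only: norm_mult norm_exp_i_times mult_1 L_def d_def)
    qed
    also have "\<dots> = fact m * ?\<epsilon>" by (simp only: sum_constant card_codes of_nat_fact)
    finally show ?thesis by (simp add: norm_divide divide_le_eq mult.commute)
  qed
  finally have 1: "cmod (?E (Suc m) - of_real ?v * ?E m) \<le> ?\<epsilon>" .
  \<comment> \<open>Multiplication by \<open>?v\<close> does not enlarge the earlier error, so the
    step errors merely add up.\<close>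
  have "?v \<le> 1" using avg_var_bounds[OF mn] by simp
  then have "?v * cmod (?E m - of_real (?V m)) \<le> 1 * (real m * ?\<epsilon>)"
    using step.IH mn by (intro mult_mono) auto
  then have 2: "cmod (of_real ?v * ?E m - of_real (?v * ?V m)) \<le> real m * ?\<epsilon>"
    by (simp only: of_real_mult right_diff_distrib[symmetric] norm_mult norm_of_real) simp
  have 3: "?V (Suc m) = ?v * ?V m"
    using m1 by (simp add: add_divide_distrib diff_divide_distrib flip: exp_add)
  have "cmod (?E (Suc m) - of_real (?V (Suc m))) \<le> cmod (?E (Suc m) - of_real ?v * ?E m)
      + cmod (of_real ?v * ?E m - of_real (?v * ?V m))"
    unfolding 3 by (rule order_trans[OF _ norm_triangle_ineq]) simp
  also have "\<dots> \<le> ?\<epsilon> + real m * ?\<epsilon>" using 1 2 by (rule add_mono)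
  also have "\<dots> = real (Suc m) * ?\<epsilon>" by (simp add: algebra_simps)
  finally show ?case .
qed

text \<open>A uniform entry on \<open>{..j}\<close> has variance
  \<open>((j + 1)\<^sup>2 - 1) / 12\<close>, and \<open>sigma_n\<close> squared is the sum of
  these.\<close>

lemma sum_avg_var: "1 \<le> n \<Longrightarrow> (\<Sum>j=1..<n. avg_var A B j) = (A\<^sup>2 + B\<^sup>2) * (sigma_n n)\<^sup>2"
proof -
  assume n: "1 \<le> n"
  have "(\<Sum>j=1..<n. avg_var A B j) = (A\<^sup>2 + B\<^sup>2) * ((2 * real n ^ 3 + 3 * real n ^ 2 - 5 * real n) / 72)"
    using n by (induction n rule: dec_induct) (simp_all add: avg_var_def field_simps power2_eq_square power3_eq_cube)
  moreover have "0 \<le> 2 * real n ^ 3 + 3 * real n ^ 2 - 5 * real n"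
  proof -
    have "2 * real n ^ 3 + 3 * real n ^ 2 - 5 * real n = real n * (real n - 1) * (2 * real n + 5)"
      by (simp add: power2_eq_square power3_eq_cube algebra_simps)
    then show ?thesis using n by simp
  qed
  ultimately show ?thesis by (simp add: sigma_n_def)
qed

text \<open>The \<open>B\<close> part of each increment contains \<open>c j - c (Suc j)\<close>,
  which telescopes to \<open>- c n\<close> as \<open>c 1 = 0\<close>; the weight
  \<open>j + 1\<close> in place of \<open>j\<close> counts every descent once too often. The last
  term undoes both.\<close>

lemma statistics_eq_sum_code_incr:
  fixes A B :: real
  assumes p: "p permutes {1..n}" and n: "1 \<le> n"
  defines "c \<equiv> lehmer_code n p"
  shows "A * (real (inv_stat p n) - m_n n) + B * (real (maj_stat p n) - m_n n) =
    (\<Sum>j=1..<n. code_incr A B j (c j) (c (Suc j))) + B * (real (c n) - (\<Sum>j=1..<n. of_bool (c j < c (Suc j))))"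
proof -
  have c1: "c 1 = 0" using n by (simp add: c_def lehmer_code_def)
  have "real (inv_stat p n) = (\<Sum>j=1..n. real (c j))"
    by (simp add: inv_stat_lehmer_code c_def)
  moreover have "real (maj_stat p n) = (\<Sum>j=1..<n. real j * of_bool (c j < c (Suc j)))"
    unfolding maj_stat_lehmer_code[OF p] c_def of_nat_sum by (intro sum.cong) auto
  moreover have "A * ((\<Sum>j=1..n. real (c j)) - m_n n)
      + B * ((\<Sum>j=1..<n. real j * of_bool (c j < c (Suc j))) - m_n n) =
    (\<Sum>j=1..<n. code_incr A B j (c j) (c (Suc j))) + B * (real (c n) - (\<Sum>j=1..<n. of_bool (c j < c (Suc j))))"
    using n
  proof (induction n rule: dec_induct)
    case base
    then show ?case by (simp add: m_n_def c1[simplified])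
  next
    case (step n)
    have "m_n (Suc n) = m_n n + real n / 2" by (simp add: m_n_def field_simps)
    with step show ?case
      by (simp add: code_incr_def[of A B n "c n" "c (Suc n)"] field_simps)
  qed
  ultimately show ?thesis by simp
qed

text \<open>Beyond the chain estimate, two replacements are paid for: dropping the remainder of
  \<open>statistics_eq_sum_code_incr\<close> costs \<open>d\<close>, and inserting the correction
  factor at level \<open>n\<close> costs \<open>d\<^sup>2\<close>.\<close>

lemma char_function_bound:
  fixes a b :: real
  assumes n: "2 \<le> n"
  defines "L \<equiv> (\<bar>a\<bar> + \<bar>b\<bar>) / sigma_n n"
  defines "d \<equiv> 2 * L * real n"
  shows "cmod ((\<Sum>p | p permutes {1..n}. iexp (a * ((real (inv_stat p n) - m_n n) / sigma_n n)
        + b * ((real (maj_stat p n) - m_n n) / sigma_n n))) / of_nat (card {p. p permutes {1..n}})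
      - of_real (exp (- (a\<^sup>2 + b\<^sup>2) / 2)))
    \<le> real n * (d ^ 3 + d ^ 4 + L\<^sup>2 * real n) + (d\<^sup>2 + d)"
proof -
  define A where "A = a / sigma_n n"
  define B where "B = b / sigma_n n"
  let ?\<epsilon> = "real n * (d ^ 3 + d ^ 4 + L\<^sup>2 * real n)"
  have "2 * real n ^ 3 + 3 * real n ^ 2 - 5 * real n = real n * (real n - 1) * (2 * real n + 5)"
    by (simp add: power2_eq_square power3_eq_cube algebra_simps)
  then have \<sigma>: "0 < sigma_n n" using n by (simp add: sigma_n_def)
  have L: "L = \<bar>A\<bar> + \<bar>B\<bar>"
    using \<sigma> by (simp add: L_def A_def B_def add_divide_distrib)
  have L0: "0 \<le> L" by (simp add: L)
  have d2: "d\<^sup>2 = 4 * (L\<^sup>2 * (real n)\<^sup>2)" by (simp add: d_def power_mult_distrib)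
  let ?S = "\<lambda>p. a * ((real (inv_stat p n) - m_n n) / sigma_n n) + b * ((real (maj_stat p n) - m_n n) / sigma_n n)"
  let ?P = "{p. p permutes {1..n}}"
  let ?T = "\<lambda>c. iexp (\<Sum>j=1..<n. code_incr A B j (c j) (c (Suc j)))"
  let ?F = "\<lambda>c. ?T c * of_real (1 - var_corr A B n (c n))"
  have card: "card ?P = fact n" by (simp add: card_permutations)
  have V: "(\<Sum>j=1..<n. avg_var A B j) = a\<^sup>2 + b\<^sup>2"
    using \<sigma> n by (subst sum_avg_var) (simp_all add: A_def B_def field_simps)
  have 1: "cmod ((\<Sum>c\<in>codes n. ?F c) / fact n - of_real (exp (- (a\<^sup>2 + b\<^sup>2) / 2))) \<le> ?\<epsilon>"
    using char_partial_sums_estimate[of n n A B] n unfolding V L[symmetric] d_def by simp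
  have reindex: "(\<Sum>c\<in>codes n. ?F c) = (\<Sum>p\<in>?P. ?F (lehmer_code n p))"
    by (rule sum.reindex_bij_betw[OF bij_betw_lehmer_code, symmetric])
  have term_le: "cmod (iexp (?S p) - ?F (lehmer_code n p)) \<le> d\<^sup>2 + d" if p: "p \<in> ?P" for p
  proof -
    let ?c = "lehmer_code n p"
    define r where "r = B * (real (?c n) - (\<Sum>j=1..<n. of_bool (?c j < ?c (Suc j))))"
    define t where "t = (\<Sum>j=1..<n. code_incr A B j (?c j) (?c (Suc j)))"
    have cn: "?c n < n" using lehmer_code_in_codes[of n p] n by (auto simp: PiE_iff)
    have "?S p = A * (real (inv_stat p n) - m_n n) + B * (real (maj_stat p n) - m_n n)"
      by (simp add: A_def B_def)
    also have "\<dots> = t + r"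
      unfolding t_def r_def using statistics_eq_sum_code_incr[of p n A B] p n by simp
    finally have S: "iexp (?S p) = iexp t * iexp r" by (simp add: exp_add distrib_left)
    \<comment> \<open>The number of descents and the last entry both lie between 0 and
      \<open>n\<close>, hence so does the modulus of their difference.\<close>
    have "0 \<le> (\<Sum>j=1..<n. of_bool (?c j < ?c (Suc j)) :: real)" by (intro sum_nonneg) auto
    moreover have "(\<Sum>j=1..<n. of_bool (?c j < ?c (Suc j)) :: real) \<le> (\<Sum>j=1..<n. 1)"
      by (intro sum_mono) auto
    ultimately have "\<bar>r\<bar> \<le> \<bar>B\<bar> * real n"
      unfolding r_def abs_mult using cn n by (intro mult_left_mono) (auto simp: abs_le_iff)
    also have "\<dots> \<le> d"
      unfolding d_def using L by (intro mult_right_mono) auto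
    finally have r: "\<bar>r\<bar> \<le> d" .
    have "iexp (?S p) - ?F ?c = iexp t * ((iexp r - 1) + of_real (var_corr A B n (?c n)))"
      unfolding S t_def[symmetric] by (simp add: algebra_simps)
    also have "cmod \<dots> \<le> \<bar>r\<bar> + \<bar>var_corr A B n (?c n)\<bar>"
      unfolding norm_mult norm_exp_i_times mult_1
      by (rule order_trans[OF norm_triangle_ineq]) (simp add: iexp_taylor0)
    also have "\<bar>var_corr A B n (?c n)\<bar> \<le> d\<^sup>2"
      using abs_var_corr_le[OF cn order_refl, of A B] unfolding L[symmetric] d2 by (simp add: field_simps)
    finally show ?thesis using r by simp
  qed
  have "cmod ((\<Sum>p\<in>?P. iexp (?S p)) - (\<Sum>p\<in>?P. ?F (lehmer_code n p))) \<le> (\<Sum>p\<in>?P. d\<^sup>2 + d)"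
    unfolding sum_subtractf[symmetric] using term_le by (rule sum_norm_le)
  also have "\<dots> = fact n * (d\<^sup>2 + d)" by (simp only: sum_constant card of_nat_fact)
  finally have "cmod (((\<Sum>p\<in>?P. iexp (?S p)) - (\<Sum>c\<in>codes n. ?F c)) / fact n) \<le> d\<^sup>2 + d"
    unfolding reindex by (simp add: norm_divide divide_le_eq mult.commute)
  with 1 have "cmod ((\<Sum>c\<in>codes n. ?F c) / fact n - of_real (exp (- (a\<^sup>2 + b\<^sup>2) / 2)))
      + cmod (((\<Sum>p\<in>?P. iexp (?S p)) - (\<Sum>c\<in>codes n. ?F c)) / fact n) \<le> ?\<epsilon> + (d\<^sup>2 + d)"
    by (rule add_mono)
  then show ?thesis
    unfolding card of_nat_fact
    by (rule order_trans[rotated], intro order_trans[OF _ norm_triangle_ineq]) (simp add: diff_divide_distrib)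
qed

text \<open>Since \<open>sigma_n\<close> grows like \<open>n\<close> to the power 3/2, the bound
  decays like \<open>n\<close> to the power -1/2.\<close>

lemma char_function_limit:
  fixes a b :: real
  shows "(\<lambda>n. (\<Sum>p | p permutes {1..n}. iexp (a * ((real (inv_stat p n) - m_n n) / sigma_n n)
        + b * ((real (maj_stat p n) - m_n n) / sigma_n n))) / of_nat (card {p. p permutes {1..n}}))
      \<longlonglongrightarrow> of_real (exp (- (a\<^sup>2 + b\<^sup>2) / 2))"
proof (rule LIM_zero_cancel, rule tendsto_0_le[where K = 1])
  define C where "C = \<bar>a\<bar> + \<bar>b\<bar>"
  let ?d = "\<lambda>n. 2 * (C / sigma_n n) * real n"
  show "(\<lambda>n. real n * ((?d n) ^ 3 + (?d n) ^ 4 + (C / sigma_n n)\<^sup>2 * real n) + ((?d n)\<^sup>2 + ?d n))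
      \<longlonglongrightarrow> 0"
  proof (cases "C = 0")
    case False
    then have "C > 0" by (simp add: C_def)
    then show ?thesis unfolding sigma_n_def by real_asymp
  qed simp
  show "\<forall>\<^sub>F n in sequentially. cmod ((\<Sum>p | p permutes {1..n}. iexp (a * ((real (inv_stat p n) - m_n n) / sigma_n n)
        + b * ((real (maj_stat p n) - m_n n) / sigma_n n))) / of_nat (card {p. p permutes {1..n}})
      - of_real (exp (- (a\<^sup>2 + b\<^sup>2) / 2)))
    \<le> norm (real n * ((?d n) ^ 3 + (?d n) ^ 4 + (C / sigma_n n)\<^sup>2 * real n) + ((?d n)\<^sup>2 + ?d n)) * 1"
    using eventually_ge_at_top[of 2]
  proof eventually_elim
    case (elim n)
    from char_function_bound[OF this, of a b] show ?case
      unfolding C_def by (simp only: mult_1_right real_norm_def) (rule order_trans[OF _ abs_ge_self])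
  qed
qed

section \<open>From characteristic functions to distribution functions\<close>

lemma measure_std_normal_singleton: "measure std_normal_distribution {x} = 0"
  by (simp add: measure_def emeasure_density nn_integral_indicator_singleton')

lemma isCont_cdf_std_normal: "isCont (cdf std_normal_distribution) x"
proof -
  interpret real_distribution std_normal_distribution by (rule real_dist_normal_dist)
  show ?thesis by (simp add: isCont_cdf measure_std_normal_singleton)
qed

text \<open>Needed because this value is the limiting total mass once the law is restricted to
  \<open>X \<le> s\<close>. As the density is positive, a null half-line would be Lebesgue null, yet
  it contains a unit interval.\<close>

lemma cdf_std_normal_pos: "0 < cdf std_normal_distribution s"
proof -
  interpret real_distribution std_normal_distribution by (rule real_dist_normal_dist)
  have "{..s} \<notin> null_sets std_normal_distribution"
  proof
    assume "{..s} \<in> null_sets std_normal_distribution"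
    then have "AE x in lborel. x \<in> {..s} \<longrightarrow> ennreal (std_normal_density x) = 0"
      by (simp add: null_sets_density_iff)
    then have "AE x in lborel. x \<notin> {..s}"
      by eventually_elim (metis ennreal_eq_0_iff normal_density_pos not_less zero_less_one)
    then have "{..s} \<in> null_sets lborel"
      by (subst AE_iff_null_sets) auto
    then have "{s - 1..s} \<in> null_sets lborel"
      by (rule null_sets_subset) auto
    then show False by (auto dest: null_setsD1)
  qed
  then have "emeasure std_normal_distribution {..s} \<noteq> 0"
    by (auto simp: null_sets_def)
  then show ?thesis
    by (simp add: cdf_def2 emeasure_eq_measure zero_less_measure_iff)
qed

lemma cdf_std_normal_eq_LBINT:
  "cdf std_normal_distribution s = (LBINT x=-\<infinity>..ereal s. exp (- x\<^sup>2 / 2)) / sqrt (2 * pi)"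
proof -
  interpret real_distribution std_normal_distribution by (rule real_dist_normal_dist)
  have "cdf std_normal_distribution s = (LINT x|std_normal_distribution. indicator {..s} x)"
    by (simp add: cdf_def2)
  also have "\<dots> = (LINT x|lborel. std_normal_density x *\<^sub>R indicator {..s} x)"
    by (subst integral_density) auto
  \<comment> \<open>Interval integrals run over the open interval, so the null endpoint
    \<open>s\<close> is removed.\<close>
  also have "\<dots> = (LINT x|lborel. (indicator {..<s} x *\<^sub>R exp (- x\<^sup>2 / 2)) / sqrt (2 * pi))"
    using AE_lborel_singleton[of s]
    by (intro integral_cong_AE) (auto simp: std_normal_density_def indicator_def)
  finally show ?thesis
    by (simp add: interval_lebesgue_integral_def set_lebesgue_integral_def einterval_def lessThan_def)
qed

text \<open>Total masses need only converge to \<open>W\<close>, so tilted and restricted laws are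
  covered: normalise, apply the continuity theorem, multiply the mass back.\<close>

lemma levy_continuity_weighted:
  fixes \<Omega> :: "nat \<Rightarrow> 'a set" and w X :: "nat \<Rightarrow> 'a \<Rightarrow> real" and W :: real
  assumes fin: "\<And>n. finite (\<Omega> n)"
    and nonneg: "\<And>n \<omega>. \<omega> \<in> \<Omega> n \<Longrightarrow> 0 \<le> w n \<omega>"
    and W: "0 < W"
    and conv: "\<And>a. (\<lambda>n. \<Sum>\<omega>\<in>\<Omega> n. of_real (w n \<omega>) * iexp (a * X n \<omega>))
      \<longlonglongrightarrow> of_real (W * exp (- a\<^sup>2 / 2))"
  shows "(\<lambda>n. \<Sum>\<omega>\<in>{\<omega>\<in>\<Omega> n. X n \<omega> \<le> s}. w n \<omega>) \<longlonglongrightarrow> W * cdf std_normal_distribution s"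
proof -
  define tot where "tot n = (\<Sum>\<omega>\<in>\<Omega> n. w n \<omega>)" for n
  \<comment> \<open>The case \<open>a = 0\<close> of the hypothesis yields the total mass.\<close>
  have tot: "tot \<longlonglongrightarrow> W"
    using tendsto_Re[OF conv[of 0]] by (simp add: tot_def[abs_def] Re_sum)
  then have pos: "eventually (\<lambda>n. 0 < tot n) sequentially"
    using W by (rule order_tendstoD)
  define P where "P n = point_measure (\<Omega> n) (\<lambda>\<omega>. w n \<omega> / tot n)" for n
  \<comment> \<open>The default value makes every \<open>M n\<close> a distribution; it is used for
    only finitely many \<open>n\<close>.\<close>
  define M where "M n = (if 0 < tot n then distr (P n) borel (X n) else std_normal_distribution)" for n
  have [measurable]: "X n \<in> borel_measurable (P n)" for n
    by (simp add: P_def measurable_point_measure_eq1)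
  have dens: "0 \<le> w n \<omega> / tot n" if "\<omega> \<in> \<Omega> n" "0 < tot n" for n \<omega>
    using nonneg that by simp
  have P: "prob_space (P n)" if "0 < tot n" for n
  proof
    have "emeasure (P n) (space (P n)) = (\<Sum>\<omega>\<in>\<Omega> n. ennreal (w n \<omega> / tot n))"
      by (simp add: P_def space_point_measure emeasure_point_measure_finite fin)
    also have "\<dots> = ennreal (\<Sum>\<omega>\<in>\<Omega> n. w n \<omega> / tot n)"
      using dens[OF _ that] by (rule sum_ennreal)
    also have "\<dots> = 1"
      using that by (simp add: tot_def flip: sum_divide_distrib)
    finally show "emeasure (P n) (space (P n)) = 1" .
  qed
  have M: "real_distribution (M n)" for n
    using prob_space.real_distribution_distr[OF P, of n "X n"] real_dist_normal_dist
    by (simp add: M_def)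
  have char_eq: "char (M n) a = (\<Sum>\<omega>\<in>\<Omega> n. of_real (w n \<omega>) * iexp (a * X n \<omega>)) / tot n"
    if "0 < tot n" for n a
  proof -
    have "char (M n) a = (LINT \<omega>|P n. iexp (a * X n \<omega>))"
      using that by (simp add: char_def M_def integral_distr)
    also have "\<dots> = (\<Sum>\<omega>\<in>\<Omega> n. (w n \<omega> / tot n) *\<^sub>R iexp (a * X n \<omega>))"
      unfolding P_def using fin dens[OF _ that] by (rule lebesgue_integral_point_measure_finite)
    finally show ?thesis
      by (simp add: scaleR_conv_of_real sum_divide_distrib)
  qed
  have cdf_eq: "cdf (M n) s = (\<Sum>\<omega>\<in>{\<omega>\<in>\<Omega> n. X n \<omega> \<le> s}. w n \<omega>) / tot n" if "0 < tot n" for n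
  proof -
    have "cdf (M n) s = measure (P n) {\<omega>\<in>\<Omega> n. X n \<omega> \<le> s}"
      using that by (simp add: cdf_def M_def measure_distr)
        (auto simp: P_def space_point_measure intro!: arg_cong[where f = "measure _"])
    also have "\<dots> = (\<Sum>\<omega>\<in>{\<omega>\<in>\<Omega> n. X n \<omega> \<le> s}. w n \<omega> / tot n)"
      unfolding P_def using measure_point_measure_finite_if[OF fin dens[OF _ that]] by simp
    finally show ?thesis by (simp add: sum_divide_distrib)
  qed
  have "(\<lambda>n. char (M n) a) \<longlonglongrightarrow> char std_normal_distribution a" for a
  proof -
    have "(\<lambda>n. (\<Sum>\<omega>\<in>\<Omega> n. of_real (w n \<omega>) * iexp (a * X n \<omega>)) / of_real (tot n))
        \<longlonglongrightarrow> of_real (W * exp (- a\<^sup>2 / 2)) / of_real W"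
      using W by (intro tendsto_divide conv tendsto_of_real tot) auto
    moreover have "of_real (W * exp (- a\<^sup>2 / 2)) / of_real W = char std_normal_distribution a"
      using W by (simp add: char_std_normal_distribution)
    ultimately show ?thesis
      using pos by (subst tendsto_cong[where g = "\<lambda>n. (\<Sum>\<omega>\<in>\<Omega> n. of_real (w n \<omega>) * iexp (a * X n \<omega>)) / of_real (tot n)"])
        (auto elim!: eventually_mono simp: char_eq)
  qed
  then have "weak_conv_m M std_normal_distribution"
    by (intro levy_continuity M real_dist_normal_dist)
  then have "(\<lambda>n. cdf (M n) s) \<longlonglongrightarrow> cdf std_normal_distribution s"
    by (simp add: weak_conv_m_def weak_conv_def isCont_cdf_std_normal)
  from tendsto_mult[OF tot this]
  show ?thesis
    by (rule Lim_transform_eventually) (use pos in \<open>auto elim!: eventually_mono simp: cdf_eq\<close>)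
qed

text \<open>The complex weight \<open>iexp (b * Y)\<close> is not a mass, so its real and imaginary
  parts are shifted by 1 to become nonnegative and the shift is subtracted afterwards.\<close>

lemma bivariate_normal_limit:
  fixes \<Omega> :: "nat \<Rightarrow> 'a set" and X Y :: "nat \<Rightarrow> 'a \<Rightarrow> real"
  assumes fin: "\<And>n. finite (\<Omega> n)"
    and conv: "\<And>a b. (\<lambda>n. (\<Sum>\<omega>\<in>\<Omega> n. iexp (a * X n \<omega> + b * Y n \<omega>)) / of_nat (card (\<Omega> n)))
      \<longlonglongrightarrow> of_real (exp (- (a\<^sup>2 + b\<^sup>2) / 2))"
  shows "(\<lambda>n. real (card {\<omega>\<in>\<Omega> n. X n \<omega> \<le> s \<and> Y n \<omega> \<le> t}) / real (card (\<Omega> n)))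
    \<longlonglongrightarrow> cdf std_normal_distribution s * cdf std_normal_distribution t"
proof -
  let ?\<Phi> = "cdf std_normal_distribution"
  let ?N = "\<lambda>n. real (card (\<Omega> n))"
  let ?A = "\<lambda>n. {\<omega>\<in>\<Omega> n. X n \<omega> \<le> s}"
  let ?\<psi> = "\<lambda>n a b. (\<Sum>\<omega>\<in>\<Omega> n. iexp (a * X n \<omega> + b * Y n \<omega>)) / of_nat (card (\<Omega> n))"
  have cos_eq: "of_real (cos y) = (iexp y + iexp (- y)) / 2" for y
    by (simp add: cos_of_real[symmetric] cos_exp_eq)
  have sin_eq: "of_real (sin y) = (iexp y - iexp (- y)) / (2 * \<i>)" for y
    by (simp add: sin_of_real[symmetric] sin_exp_eq)
  have weight: "complex_of_real ((1 + x) / real k) = (1 + of_real x) / of_nat k" for x k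
    by simp
  have iexp_split: "iexp (x + y) = iexp x * iexp y" for x y
    by (simp add: exp_add distrib_left)
  \<comment> \<open>Here \<open>E\<close>, \<open>F\<close>, \<open>G\<close> stand for
    \<open>iexp\<close> of \<open>a * X\<close>, \<open>b * Y\<close>, \<open>- (b * Y)\<close>; the
    case \<open>N = 0\<close> covers an empty \<open>\<Omega> n\<close>.\<close>
  have ring_cos: "E * iexp 0 / N + (E * F / N + E * G / N) / 2 = (1 + (F + G) / 2) / N * E"
    for E F G N :: complex
    by (cases "N = 0") (simp_all add: field_simps)
  have ring_sin: "E * iexp 0 / N + (E * F / N - E * G / N) / (2 * \<i>) = (1 + (F - G) / (2 * \<i>)) / N * E"
    for E F G N :: complex
    by (cases "N = 0") (simp_all add: field_simps)
  have cos_tilt: "(\<lambda>n. \<Sum>\<omega>\<in>?A n. (1 + cos (b * Y n \<omega>)) / ?N n)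
      \<longlonglongrightarrow> (1 + exp (- b\<^sup>2 / 2)) * ?\<Phi> s" for b
  proof (rule levy_continuity_weighted[OF fin])
    show "0 \<le> (1 + cos (b * Y n \<omega>)) / ?N n" for n \<omega>
      using cos_ge_minus_one[of "b * Y n \<omega>"] by (intro divide_nonneg_nonneg) linarith+
    show "0 < 1 + exp (- b\<^sup>2 / 2)" by (simp add: add_pos_pos)
    fix a
    have "(\<lambda>n. ?\<psi> n a 0 + (?\<psi> n a b + ?\<psi> n a (- b)) / 2)
        \<longlonglongrightarrow> of_real (exp (- (a\<^sup>2 + 0\<^sup>2) / 2))
          + (of_real (exp (- (a\<^sup>2 + b\<^sup>2) / 2)) + of_real (exp (- (a\<^sup>2 + (- b)\<^sup>2) / 2))) / 2"
      by (intro tendsto_intros conv) auto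
    also have "of_real (exp (- (a\<^sup>2 + 0\<^sup>2) / 2))
          + (of_real (exp (- (a\<^sup>2 + b\<^sup>2) / 2)) + of_real (exp (- (a\<^sup>2 + (- b)\<^sup>2) / 2))) / (2::complex)
        = of_real ((1 + exp (- b\<^sup>2 / 2)) * exp (- a\<^sup>2 / 2))"
      by (simp add: algebra_simps add_divide_distrib diff_divide_distrib flip: exp_add of_real_mult)
    also have "(\<lambda>n. ?\<psi> n a 0 + (?\<psi> n a b + ?\<psi> n a (- b)) / 2) =
        (\<lambda>n. \<Sum>\<omega>\<in>\<Omega> n. of_real ((1 + cos (b * Y n \<omega>)) / ?N n) * iexp (a * X n \<omega>))"
      by (simp only: sum_divide_distrib sum.distrib[symmetric] iexp_split mult_zero_left minus_mult_left[symmetric]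
          weight cos_eq ring_cos)
    finally show "(\<lambda>n. \<Sum>\<omega>\<in>\<Omega> n. of_real ((1 + cos (b * Y n \<omega>)) / ?N n) * iexp (a * X n \<omega>))
        \<longlonglongrightarrow> of_real ((1 + exp (- b\<^sup>2 / 2)) * exp (- a\<^sup>2 / 2))" .
  qed
  \<comment> \<open>The limiting mass is 1 because the limit is even in \<open>b\<close> and the
    sine part cancels.\<close>
  have sin_tilt: "(\<lambda>n. \<Sum>\<omega>\<in>?A n. (1 + sin (b * Y n \<omega>)) / ?N n) \<longlonglongrightarrow> 1 * ?\<Phi> s" for b
  proof (rule levy_continuity_weighted[OF fin])
    show "0 \<le> (1 + sin (b * Y n \<omega>)) / ?N n" for n \<omega>
      using sin_ge_minus_one[of "b * Y n \<omega>"] by (intro divide_nonneg_nonneg) linarith+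
    fix a
    have "(\<lambda>n. ?\<psi> n a 0 + (?\<psi> n a b - ?\<psi> n a (- b)) / (2 * \<i>))
        \<longlonglongrightarrow> of_real (exp (- (a\<^sup>2 + 0\<^sup>2) / 2))
          + (of_real (exp (- (a\<^sup>2 + b\<^sup>2) / 2)) - of_real (exp (- (a\<^sup>2 + (- b)\<^sup>2) / 2))) / (2 * \<i>)"
      by (intro tendsto_intros conv) auto
    also have "of_real (exp (- (a\<^sup>2 + 0\<^sup>2) / 2))
          + (of_real (exp (- (a\<^sup>2 + b\<^sup>2) / 2)) - of_real (exp (- (a\<^sup>2 + (- b)\<^sup>2) / 2))) / (2 * \<i>)
        = of_real (1 * exp (- a\<^sup>2 / 2))"
      by simp
    also have "(\<lambda>n. ?\<psi> n a 0 + (?\<psi> n a b - ?\<psi> n a (- b)) / (2 * \<i>)) =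
        (\<lambda>n. \<Sum>\<omega>\<in>\<Omega> n. of_real ((1 + sin (b * Y n \<omega>)) / ?N n) * iexp (a * X n \<omega>))"
      by (simp only: sum_divide_distrib sum.distrib[symmetric] sum_subtractf[symmetric] iexp_split
          mult_zero_left minus_mult_left[symmetric] weight sin_eq ring_sin)
    finally show "(\<lambda>n. \<Sum>\<omega>\<in>\<Omega> n. of_real ((1 + sin (b * Y n \<omega>)) / ?N n) * iexp (a * X n \<omega>))
        \<longlonglongrightarrow> of_real (1 * exp (- a\<^sup>2 / 2))" .
  qed simp
  have "(\<lambda>n. \<Sum>\<omega>\<in>{\<omega>\<in>?A n. Y n \<omega> \<le> t}. 1 / ?N n) \<longlonglongrightarrow> ?\<Phi> s * ?\<Phi> t"
  proof (rule levy_continuity_weighted)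
    show "0 < ?\<Phi> s" by (rule cdf_std_normal_pos)
    fix b
    let ?c = "\<lambda>n b. \<Sum>\<omega>\<in>?A n. (1 + cos (b * Y n \<omega>)) / ?N n"
    let ?s = "\<lambda>n b. \<Sum>\<omega>\<in>?A n. (1 + sin (b * Y n \<omega>)) / ?N n"
    \<comment> \<open>At \<open>b = 0\<close> the cosine weights are \<open>2 / ?N n\<close> and the
      sine weights \<open>1 / ?N n\<close>; the subtractions leave the pure cosine and sine
      sums.\<close>
    have "(\<lambda>n. of_real (?c n b - ?c n 0 / 2) + \<i> * of_real (?s n b - ?s n 0))
        \<longlonglongrightarrow> of_real ((1 + exp (- b\<^sup>2 / 2)) * ?\<Phi> s - (1 + exp (- 0\<^sup>2 / 2)) * ?\<Phi> s / 2)
          + \<i> * of_real (1 * ?\<Phi> s - 1 * ?\<Phi> s)"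
      by (intro tendsto_add tendsto_mult tendsto_const tendsto_of_real tendsto_diff
          tendsto_divide cos_tilt sin_tilt) auto
    also have "of_real ((1 + exp (- b\<^sup>2 / 2)) * ?\<Phi> s - (1 + exp (- 0\<^sup>2 / 2)) * ?\<Phi> s / 2)
          + \<i> * of_real (1 * ?\<Phi> s - 1 * ?\<Phi> s) = of_real (?\<Phi> s * exp (- b\<^sup>2 / 2))"
      by (simp add: algebra_simps)
    also have "(\<lambda>n. of_real (?c n b - ?c n 0 / 2) + \<i> * of_real (?s n b - ?s n 0))
        = (\<lambda>n. \<Sum>\<omega>\<in>?A n. of_real (1 / ?N n) * iexp (b * Y n \<omega>))"
    proof
      fix n
      have "?c n b - ?c n 0 / 2 = (\<Sum>\<omega>\<in>?A n. cos (b * Y n \<omega>) / ?N n)"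
        "?s n b - ?s n 0 = (\<Sum>\<omega>\<in>?A n. sin (b * Y n \<omega>) / ?N n)"
        by (simp_all add: add_divide_distrib sum.distrib)
      then show "of_real (?c n b - ?c n 0 / 2) + \<i> * of_real (?s n b - ?s n 0)
          = (\<Sum>\<omega>\<in>?A n. of_real (1 / ?N n) * iexp (b * Y n \<omega>))"
        by (simp add: complex_eq_iff Re_exp Im_exp)
    qed
    finally show "(\<lambda>n. \<Sum>\<omega>\<in>?A n. of_real (1 / ?N n) * iexp (b * Y n \<omega>))
        \<longlonglongrightarrow> of_real (?\<Phi> s * exp (- b\<^sup>2 / 2))" .
  qed (use fin in auto)
  then show ?thesis by (simp add: conj_assoc)
qed

theorem mainTheorem1:
  fixes s t :: real
  shows "(\<lambda>n. joint_prob n s t) \<longlonglongrightarrow>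
     (1 / (2 * pi)) *
       (LBINT x=-\<infinity>..ereal s. (LBINT y=-\<infinity>..ereal t. exp (- x\<^sup>2 / 2 - y\<^sup>2 / 2)))"
proof -
  have "(\<lambda>n. joint_prob n s t) \<longlonglongrightarrow> cdf std_normal_distribution s * cdf std_normal_distribution t"
    using bivariate_normal_limit[OF finite_permutations[OF finite_atLeastAtMost] char_function_limit, of s t]
    by (simp add: joint_prob_def)
  also have "cdf std_normal_distribution s * cdf std_normal_distribution t =
      (1 / (2 * pi)) * ((LBINT x=-\<infinity>..ereal s. exp (- x\<^sup>2 / 2)) * (LBINT y=-\<infinity>..ereal t. exp (- y\<^sup>2 / 2)))"
    by (simp add: cdf_std_normal_eq_LBINT)
  also have "(LBINT x=-\<infinity>..ereal s. exp (- x\<^sup>2 / 2)) * (LBINT y=-\<infinity>..ereal t. exp (- y\<^sup>2 / 2)) =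
      (LBINT x=-\<infinity>..ereal s. (LBINT y=-\<infinity>..ereal t. exp (- x\<^sup>2 / 2 - y\<^sup>2 / 2)))"
  proof -
    have "exp (- x\<^sup>2 / 2 - y\<^sup>2 / 2) = exp (- x\<^sup>2 / 2) * exp (- y\<^sup>2 / 2)" for x y :: real
      by (simp flip: exp_add)
    then show ?thesis by simp
  qed
  finally show ?thesis .
qed

end
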